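(* Let $N$ be a positive integer, let $\rho\in[0,1]$, and let $x\geq 0$ and $y$ be real numbers. If \[ \#\{n\leq N : \tau(n)-2\geq x\} \geq y, \] then \[ \mathbf{E}[\#\Phi(\mathcal{D}_{\rho}(N))] \geq y\left(1 - \rho(2\rho-\rho^2)^{x} - (1-\rho)(1-\rho^2)^{x}\right). \]
   Context: For a positive integer $m$, $\tau(m)$ denotes the number of positive divisors of $m$. The divisor graph $G_N$ is the simple graph with vertex set $\{1,\dots,N\}$ and an edge between distinct $a,b$ iff $a\mid b$ or $b\mid a$. The oriented divisor graph $D_N$ is the orientation of $G_N$ in which every edge $\{a,b\}$ with $b\mid a$, $a>b$ is directed from $a$ to $b$. For $\rho\in[0,1]$, the randomly oriented divisor graph $\mathcal{D}_\rho(N)$ is the random orientation of $G_N$ obtained from $D_N$ by independently reversing the direction of each edge with probability $\rho$ (so an orientation differing from $D_N$ in exactly $f$ of the $|E|$ edges has probability $\rho^f(1-\rho)^{|E|-f}$). A strongly connected component of a directed graph is a maximal subgraph in which there is a directed path between every pair of its vertices; the vertex sets of the strongly connected components partition the vertex set. $\#\Phi(\mathcal{D}_\rho(N))$ denotes the random variable giving the number of vertices of the largest strongly connected component of $\mathcal{D}_\rho(N)$, and $\mathbf{E}$ denotes expectation. *)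

theory Defs
  imports "HOL-Probability.Product_PMF" "Graph_Theory.Digraph_Component"
begin

definition tau :: "nat \<Rightarrow> nat" where
  "tau m = card {d. d > 0 \<and> d dvd m}"

text \<open>As usual for \<^locale>\<open>pair_graph\<close>, a simple graph is a symmetric loop-free digraph:
  each edge \<open>{a, b}\<close> is represented by the two pairs \<open>(a, b)\<close> and \<open>(b, a)\<close>.\<close>

definition divisor_graph :: "nat \<Rightarrow> nat pair_pre_digraph" where
  "divisor_graph N =
     \<lparr>pverts = {1..N},
      parcs = {(a, b). a \<in> {1..N} \<and> b \<in> {1..N} \<and> a \<noteq> b \<and> (a dvd b \<or> b dvd a)}\<rparr>"

definition oriented_divisor_graph :: "nat \<Rightarrow> nat pair_pre_digraph" where
  "oriented_divisor_graph N =
     \<lparr>pverts = pverts (divisor_graph N),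
      parcs = {(a, b). (a, b) \<in> parcs (divisor_graph N) \<and> b dvd a \<and> a > b}\<rparr>"

definition reverse_arcs :: "'a rel \<Rightarrow> 'a pair_pre_digraph \<Rightarrow> 'a pair_pre_digraph" where
  "reverse_arcs R D =
     \<lparr>pverts = pverts D, parcs = (parcs D - R) \<union> (parcs D \<inter> R)\<inverse>\<rparr>"

definition random_divisor_graph :: "real \<Rightarrow> nat \<Rightarrow> nat pair_pre_digraph pmf" where
  "random_divisor_graph \<rho> N =
     map_pmf (\<lambda>flip. reverse_arcs {e. flip e} (oriented_divisor_graph N))
       (Pi_pmf (parcs (oriented_divisor_graph N)) False (\<lambda>_. bernoulli_pmf \<rho>))"

definition largest_scc_size :: "'a pair_pre_digraph \<Rightarrow> nat" where
  "largest_scc_size D = Max ((\<lambda>H. card (verts H)) ` pre_digraph.sccs (with_proj D))"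

lemma pair_graph_divisor_graph: "pair_graph (divisor_graph N)"
proof -
  have "finite (parcs (divisor_graph N))"
    by (rule finite_subset[of _ "{1..N} \<times> {1..N}"]) (auto simp: divisor_graph_def)
  then show ?thesis
    by unfold_locales (auto simp: divisor_graph_def symmetric_def sym_def)
qed

lemma mk_symmetric_oriented_divisor_graph:
  "mk_symmetric (with_proj (oriented_divisor_graph N)) = divisor_graph N"
proof -
  have lt: "b < a" if "b dvd a" "a \<noteq> b" "Suc 0 \<le> a" for a b :: nat
    using that dvd_imp_le[of b a] by linarith
  have "(\<Union>(a, b)\<in>parcs (oriented_divisor_graph N). {(a, b), (b, a)}) = parcs (divisor_graph N)"
    by (fastforce simp: oriented_divisor_graph_def divisor_graph_def dest: lt)
  then show ?thesis
    by (simp add: mk_symmetric_def case_prod_unfold)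
       (simp add: oriented_divisor_graph_def divisor_graph_def)
qed

lemma finite_parcs_oriented_divisor_graph: "finite (parcs (oriented_divisor_graph N))"
  by (rule finite_subset[of _ "{1..N} \<times> {1..N}"])
     (auto simp: oriented_divisor_graph_def divisor_graph_def)

lemma pmf_random_divisor_graph:
  assumes "\<rho> \<in> {0..1}" and R: "R \<subseteq> parcs (oriented_divisor_graph N)"
  shows "pmf (random_divisor_graph \<rho> N) (reverse_arcs R (oriented_divisor_graph N)) =
           \<rho> ^ card R * (1 - \<rho>) ^ (card (parcs (oriented_divisor_graph N)) - card R)"
proof -
  let ?D = "oriented_divisor_graph N"
  let ?E = "parcs ?D"
  let ?P = "Pi_pmf ?E False (\<lambda>_. bernoulli_pmf \<rho>)"
  let ?f = "\<lambda>flip. reverse_arcs {e. flip e} ?D"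
  have fin: "finite ?E" by (rule finite_parcs_oriented_divisor_graph)
  have arcs: "parcs (reverse_arcs S ?D) \<inter> {(a, b). b < a} = ?E - S" for S
    by (auto simp: reverse_arcs_def oriented_divisor_graph_def)
  have eq: "flip = (\<lambda>e. e \<in> R)"
    if "flip \<in> set_pmf ?P" "?f flip = reverse_arcs R ?D" for flip
  proof -
    have "?E - {e. flip e} = ?E - R" using arcs that(2) by metis
    moreover have "\<And>e. e \<notin> ?E \<Longrightarrow> \<not> flip e"
      using set_Pi_pmf_subset[OF fin, of False "\<lambda>_. bernoulli_pmf \<rho>"] that(1) by blast
    ultimately show ?thesis using R by (auto simp: fun_eq_iff)
  qed
  have "pmf (random_divisor_graph \<rho> N) (reverse_arcs R ?D)
        = measure_pmf.prob ?P (?f -` {reverse_arcs R ?D})"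
    by (simp add: random_divisor_graph_def pmf_map)
  also have "\<dots> = measure_pmf.prob ?P {\<lambda>e. e \<in> R}"
    by (rule measure_pmf.finite_measure_eq_AE) (auto simp: AE_measure_pmf_iff dest: eq)
  also have "\<dots> = (\<Prod>e\<in>?E. pmf (bernoulli_pmf \<rho>) (e \<in> R))"
    using R fin by (subst measure_pmf_single) (auto simp: pmf_Pi)
  also have "\<dots> = (\<Prod>e\<in>?E. if e \<in> R then \<rho> else 1 - \<rho>)"
    using assms(1) by (intro prod.cong) auto
  also have "\<dots> = \<rho> ^ card R * (1 - \<rho>) ^ card (?E - R)"
    using fin R by (simp add: prod.If_cases Int_absorb1 Diff_eq)
  also have "card (?E - R) = card ?E - card R"
    using fin R by (simp add: card_Diff_subset finite_subset)
  finally show ?thesis .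
qed

end

theory Submission
  imports Defs
begin

text \<open>
  Lower-bound the largest strongly connected component by the one containing \<open>1\<close>. Whichever way
  the edge \<open>{n, 1}\<close> is oriented, \<open>n\<close> lies in that component as soon as some divisor \<open>d\<close> of \<open>n\<close> with
  \<open>1 < d < n\<close> closes it to a directed triangle. If the edge is reversed (probability \<open>\<rho>\<close>), a given
  \<open>d\<close> fails with probability \<open>1 - (1 - \<rho>)\<^sup>2 = 2\<rho> - \<rho>\<^sup>2\<close>; if it is not, with probability \<open>1 - \<rho>\<^sup>2\<close>.
  The \<open>\<tau>(n) - 2\<close> candidate triangles share only the edge \<open>{n, 1}\<close>, so these failures are
  independent. Linearity of expectation over the \<open>n\<close> counted in the hypothesis finishes the proof.
\<close>

section \<open>Independence of disjoint coordinate blocks\<close>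

text \<open>Intersecting with the supports changes no probability and makes both factors countable,
  which is what \<open>measure_pmf_prob_product\<close> asks for.\<close>

lemma prob_pair_pmf_Times:
  "measure_pmf.prob (pair_pmf M N) (A \<times> B) = measure_pmf.prob M A * measure_pmf.prob N B"
proof -
  have "measure_pmf.prob (pair_pmf M N) (A \<times> B)
        = measure_pmf.prob (pair_pmf M N) ((A \<times> B) \<inter> set_pmf (pair_pmf M N))"
    by (simp only: measure_Int_set_pmf)
  also have "(A \<times> B) \<inter> set_pmf (pair_pmf M N) = (A \<inter> set_pmf M) \<times> (B \<inter> set_pmf N)"
    by auto
  also have "measure_pmf.prob (pair_pmf M N) \<dots>
        = measure_pmf.prob M (A \<inter> set_pmf M) * measure_pmf.prob N (B \<inter> set_pmf N)"
    by (intro measure_pmf_prob_product countable_Int2 countable_set_pmf)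
  finally show ?thesis by (simp only: measure_Int_set_pmf)
qed

text \<open>The congruence hypotheses say that \<open>P\<close> reads only coordinates in
  \<open>A\<close> and \<open>Q\<close> only those in \<open>B\<close>. Cutting \<open>I\<close>
  into \<open>A\<close> and \<open>I - A\<close> turns the product into a pair of independent
  functions; as \<open>B\<close> misses \<open>A\<close>, the event \<open>Q\<close> is decided by
  the second one.\<close>

lemma prob_Pi_pmf_conj:
  assumes fin: "finite I" and sub: "A \<subseteq> I" and disj: "A \<inter> B = {}"
    and P: "\<And>h h'. (\<And>i. i \<in> A \<Longrightarrow> h i = h' i) \<Longrightarrow> P h = P h'"
    and Q: "\<And>h h'. (\<And>i. i \<in> B \<Longrightarrow> h i = h' i) \<Longrightarrow> Q h = Q h'"
  shows "measure_pmf.prob (Pi_pmf I dflt p) {h. P h \<and> Q h}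
       = measure_pmf.prob (Pi_pmf I dflt p) {h. P h} * measure_pmf.prob (Pi_pmf I dflt p) {h. Q h}"
proof -
  let ?M = "Pi_pmf A dflt p" and ?N = "Pi_pmf (I - A) dflt p"
  let ?m = "\<lambda>(f, g) x. if x \<in> A then f x else g x"
  \<comment> \<open>Generic predicates allow three uses: for \<open>P\<close> and \<open>Q\<close>
    together, and for each of them paired with \<open>True\<close>. The last two identify the
    factors over \<open>A\<close> and \<open>I - A\<close> with probabilities over all of
    \<open>I\<close>.\<close>
  have *: "measure_pmf.prob (Pi_pmf I dflt p) {h. P' h \<and> Q' h}
        = measure_pmf.prob ?M {h. P' h} * measure_pmf.prob ?N {h. Q' h}"
    if P': "\<And>h h'. (\<And>i. i \<in> A \<Longrightarrow> h i = h' i) \<Longrightarrow> P' h = P' h'"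
      and Q': "\<And>h h'. (\<And>i. i \<in> B \<Longrightarrow> h i = h' i) \<Longrightarrow> Q' h = Q' h'" for P' Q'
  proof -
    have "Pi_pmf I dflt p = map_pmf ?m (pair_pmf ?M ?N)"
      using Pi_pmf_union[of A "I - A" dflt p] fin sub finite_subset[OF sub fin]
      by (simp add: Un_absorb1)
    moreover have "?m -` {h. P' h \<and> Q' h} = {h. P' h} \<times> {h. Q' h}"
    proof -
      have "P' (?m (f, g)) = P' f" "Q' (?m (f, g)) = Q' g" for f g
        using disj by (auto intro!: P' Q')
      then show ?thesis by auto
    qed
    ultimately show ?thesis by (simp only: measure_map_pmf prob_pair_pmf_Times)
  qed
  show ?thesis
    using *[of P Q, OF P Q] *[of P "\<lambda>_. True", OF P] *[of "\<lambda>_. True" Q, OF _ Q] by simp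
qed

text \<open>\<open>K j\<close> is the block of coordinates that \<open>Q j\<close> reads. Induction
  on \<open>L\<close> splits off one block at a time, since it is disjoint from the union of the
  others.\<close>

lemma prob_Pi_pmf_Ball:
  assumes fin: "finite I" and "finite L" and disj: "disjoint_family_on K L"
    and sub: "\<And>j. j \<in> L \<Longrightarrow> K j \<subseteq> I"
    and Q: "\<And>j h h'. j \<in> L \<Longrightarrow> (\<And>i. i \<in> K j \<Longrightarrow> h i = h' i) \<Longrightarrow> Q j h = Q j h'"
  shows "measure_pmf.prob (Pi_pmf I dflt p) {h. \<forall>j\<in>L. Q j h}
       = (\<Prod>j\<in>L. measure_pmf.prob (Pi_pmf I dflt p) {h. Q j h})"
  using \<open>finite L\<close> disj sub Q
proof (induction L rule: finite_induct)
  case empty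
  show ?case by simp
next
  case (insert l L)
  have "measure_pmf.prob (Pi_pmf I dflt p) {h. Q l h \<and> (\<forall>j\<in>L. Q j h)}
      = measure_pmf.prob (Pi_pmf I dflt p) {h. Q l h}
        * measure_pmf.prob (Pi_pmf I dflt p) {h. \<forall>j\<in>L. Q j h}"
  proof (rule prob_Pi_pmf_conj[OF fin])
    show "K l \<subseteq> I" using insert.prems(2) by simp
    show "K l \<inter> (\<Union>j\<in>L. K j) = {}"
      using insert.prems(1) insert.hyps by (force simp: disjoint_family_on_def)
    show "Q l h = Q l h'" if "\<And>i. i \<in> K l \<Longrightarrow> h i = h' i" for h h'
      using that by (intro insert.prems(3)) auto
    show "(\<forall>j\<in>L. Q j h) = (\<forall>j\<in>L. Q j h')" if "\<And>i. i \<in> (\<Union>j\<in>L. K j) \<Longrightarrow> h i = h' i" for h h'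
      using that by (intro ball_cong insert.prems(3)) auto
  qed
  moreover have "measure_pmf.prob (Pi_pmf I dflt p) {h. \<forall>j\<in>L. Q j h}
      = (\<Prod>j\<in>L. measure_pmf.prob (Pi_pmf I dflt p) {h. Q j h})"
  proof (rule insert.IH)
    show "disjoint_family_on K L"
      using insert.prems(1) by (rule disjoint_family_on_mono[rotated]) auto
    show "Q j h = Q j h'" if "j \<in> L" "\<And>i. i \<in> K j \<Longrightarrow> h i = h' i" for j h h'
      using that by (intro insert.prems(3)) auto
  qed (use insert.prems(2) in auto)
  ultimately show ?case using insert.hyps by simp
qed

section \<open>Biased coins: single coins, pairs, and disjoint families of pairs\<close>

context
  fixes I :: "'a set" and \<rho> :: real
  assumes fin: "finite I" and \<rho>: "\<rho> \<in> {0..1}"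
begin

private abbreviation coins :: "('a \<Rightarrow> bool) pmf" where
  "coins \<equiv> Pi_pmf I False (\<lambda>_. bernoulli_pmf \<rho>)"

lemma prob_coin:
  assumes "e \<in> I"
  shows "measure_pmf.prob coins {h. h e} = \<rho>" "measure_pmf.prob coins {h. \<not> h e} = 1 - \<rho>"
proof -
  have *: "measure_pmf.prob coins {h. h e = b} = pmf (bernoulli_pmf \<rho>) b" for b
  proof -
    have "measure_pmf.prob coins {h. h e = b} = pmf (map_pmf (\<lambda>h. h e) coins) b"
      by (simp add: pmf_map vimage_def)
    then show ?thesis using fin assms by (simp add: Pi_pmf_component)
  qed
  show "measure_pmf.prob coins {h. h e} = \<rho>" "measure_pmf.prob coins {h. \<not> h e} = 1 - \<rho>"
    using *[of True] *[of False] \<rho> by simp_all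
qed

lemma prob_two_coins:
  assumes "e \<in> I" "e' \<in> I" "e \<noteq> e'"
  shows "measure_pmf.prob coins {h. \<not> (h e \<and> h e')} = 1 - \<rho>\<^sup>2"
    and "measure_pmf.prob coins {h. h e \<or> h e'} = 2 * \<rho> - \<rho>\<^sup>2"
proof -
  have "measure_pmf.prob coins {h. h e \<and> h e'} = \<rho> * \<rho>"
    using assms prob_Pi_pmf_conj[OF fin, of "{e}" "{e'}" "\<lambda>h. h e" "\<lambda>h. h e'"]
    by (simp add: prob_coin)
  moreover have "{h. \<not> (h e \<and> h e')} = - {h. h e \<and> h e'}" by auto
  ultimately show "measure_pmf.prob coins {h. \<not> (h e \<and> h e')} = 1 - \<rho>\<^sup>2"
    by (simp add: measure_pmf.prob_compl[of _ coins, simplified] Compl_eq_Diff_UNIV power2_eq_square)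
  have "measure_pmf.prob coins {h. \<not> h e \<and> \<not> h e'} = (1 - \<rho>) * (1 - \<rho>)"
    using assms prob_Pi_pmf_conj[OF fin, of "{e}" "{e'}" "\<lambda>h. \<not> h e" "\<lambda>h. \<not> h e'"]
    by (simp add: prob_coin)
  moreover have "{h. h e \<or> h e'} = - {h. \<not> h e \<and> \<not> h e'}" by auto
  ultimately show "measure_pmf.prob coins {h. h e \<or> h e'} = 2 * \<rho> - \<rho>\<^sup>2"
    by (simp add: measure_pmf.prob_compl[of _ coins, simplified] Compl_eq_Diff_UNIV
        power2_eq_square algebra_simps)
qed

lemma prob_coin_and_pairs:
  assumes e: "e \<in> I" and L: "finite L" and disj: "disjoint_family_on (\<lambda>d. {f d, g d}) L"
    and mem: "\<And>d. d \<in> L \<Longrightarrow> f d \<in> I \<and> g d \<in> I \<and> f d \<noteq> g d \<and> f d \<noteq> e \<and> g d \<noteq> e"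
  shows "measure_pmf.prob coins {h. h e \<and> (\<forall>d\<in>L. h (f d) \<or> h (g d))}
           = \<rho> * (2 * \<rho> - \<rho>\<^sup>2) ^ card L"
    and "measure_pmf.prob coins {h. \<not> h e \<and> (\<forall>d\<in>L. \<not> (h (f d) \<and> h (g d)))}
           = (1 - \<rho>) * (1 - \<rho>\<^sup>2) ^ card L"
proof -
  \<comment> \<open>One factorisation serves both claims: \<open>P\<close> is the condition on the
    coin \<open>e\<close>, and \<open>Q\<close> the condition on each pair.\<close>
  have split: "measure_pmf.prob coins {h. P (h e) \<and> (\<forall>d\<in>L. Q (h (f d)) (h (g d)))}
      = measure_pmf.prob coins {h. P (h e)}
        * (\<Prod>d\<in>L. measure_pmf.prob coins {h. Q (h (f d)) (h (g d))})" for P Q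
  proof -
    have "measure_pmf.prob coins {h. P (h e) \<and> (\<forall>d\<in>L. Q (h (f d)) (h (g d)))}
        = measure_pmf.prob coins {h. P (h e)}
          * measure_pmf.prob coins {h. \<forall>d\<in>L. Q (h (f d)) (h (g d))}"
    proof (rule prob_Pi_pmf_conj[OF fin, of "{e}" "\<Union>d\<in>L. {f d, g d}"])
      show "(\<forall>d\<in>L. Q (h (f d)) (h (g d))) = (\<forall>d\<in>L. Q (h' (f d)) (h' (g d)))"
        if "\<And>i. i \<in> (\<Union>d\<in>L. {f d, g d}) \<Longrightarrow> h i = h' i" for h h'
        using that by (intro ball_cong arg_cong2[of _ _ _ _ Q]) auto
    qed (use e mem in auto)
    also have "measure_pmf.prob coins {h. \<forall>d\<in>L. Q (h (f d)) (h (g d))}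
        = (\<Prod>d\<in>L. measure_pmf.prob coins {h. Q (h (f d)) (h (g d))})"
      by (rule prob_Pi_pmf_Ball[OF fin L disj]) (use mem in auto)
    finally show ?thesis .
  qed
  have "(\<Prod>d\<in>L. measure_pmf.prob coins {h. h (f d) \<or> h (g d)}) = (\<Prod>d\<in>L. 2 * \<rho> - \<rho>\<^sup>2)"
    using mem by (intro prod.cong prob_two_coins refl) auto
  then show "measure_pmf.prob coins {h. h e \<and> (\<forall>d\<in>L. h (f d) \<or> h (g d))}
           = \<rho> * (2 * \<rho> - \<rho>\<^sup>2) ^ card L"
    using split[of "\<lambda>b. b" "(\<or>)"] e by (simp add: prob_coin)
  have "(\<Prod>d\<in>L. measure_pmf.prob coins {h. \<not> (h (f d) \<and> h (g d))}) = (\<Prod>d\<in>L. 1 - \<rho>\<^sup>2)"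
    using mem by (intro prod.cong prob_two_coins refl) auto
  then show "measure_pmf.prob coins {h. \<not> h e \<and> (\<forall>d\<in>L. \<not> (h (f d) \<and> h (g d)))}
           = (1 - \<rho>) * (1 - \<rho>\<^sup>2) ^ card L"
    using split[of Not "\<lambda>a b. \<not> (a \<and> b)"] e by (simp add: prob_coin)
qed

end

section \<open>The strongly connected component of 1\<close>

lemma (in pair_fin_digraph) card_scc_of_le_largest_scc_size:
  assumes "u \<in> pverts G"
  shows "card (scc_of u) \<le> largest_scc_size G"
proof -
  have eq: "(\<lambda>H. card (verts H)) ` sccs = card ` sccs_verts"
    by (simp add: sccs_verts_conv image_image)
  show ?thesis
    unfolding largest_scc_size_def eq
    using finite_sccs_verts scc_of_in_sccs_verts[of u] assms by (intro Max_ge) auto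
qed

lemma pair_fin_digraph_reverse_arcs:
  assumes "pair_fin_digraph D"
  shows "pair_fin_digraph (reverse_arcs R D)"
proof -
  interpret pair_fin_digraph D by fact
  show ?thesis
    by unfold_locales (auto simp: reverse_arcs_def dest: in_arcsD1 in_arcsD2)
qed

lemma pair_fin_digraph_oriented_divisor_graph: "pair_fin_digraph (oriented_divisor_graph N)"
  using finite_parcs_oriented_divisor_graph
  by unfold_locales (auto simp: oriented_divisor_graph_def divisor_graph_def)

section \<open>Triangles through 1 and n\<close>

definition mid_divisors :: "nat \<Rightarrow> nat set" where
  "mid_divisors n = {d. d dvd n \<and> 1 < d \<and> d < n}"

lemma finite_mid_divisors: "finite (mid_divisors n)"
  by (rule finite_subset[of _ "{..<n}"]) (auto simp: mid_divisors_def)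

text \<open>The subtracted 2 accounts for the divisors 1 and \<open>n\<close>, which are distinct
  because \<open>n \<ge> 2\<close>.\<close>

lemma card_mid_divisors:
  assumes "n \<ge> 2"
  shows "real (card (mid_divisors n)) = real (tau n) - 2"
proof -
  have "{d. d > 0 \<and> d dvd n} = insert 1 (insert n (mid_divisors n))"
    using assms by (auto simp: mid_divisors_def dest: dvd_imp_le)
  moreover have "1 \<notin> insert n (mid_divisors n)" "n \<notin> mid_divisors n"
    using assms by (auto simp: mid_divisors_def)
  ultimately show ?thesis
    using finite_mid_divisors[of n] by (simp add: tau_def)
qed

text \<open>If neither alternative holds, some \<open>d\<close> closes a directed triangle: 1 to
  \<open>n\<close> to \<open>d\<close> to 1 when only the edge \<open>(n, 1)\<close> is reversed,
  and \<open>n\<close> to 1 to \<open>d\<close> to \<open>n\<close> when only the other two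
  are.\<close>

lemma not_in_scc_of_1:
  assumes n: "n \<in> {2..N}"
    and notin: "n \<notin> pre_digraph.scc_of (with_proj (reverse_arcs {e. flip e} (oriented_divisor_graph N))) 1"
  shows "(flip (n, 1) \<and> (\<forall>d\<in>mid_divisors n. flip (n, d) \<or> flip (d, 1))) \<or>
         (\<not> flip (n, 1) \<and> (\<forall>d\<in>mid_divisors n. \<not> (flip (n, d) \<and> flip (d, 1))))"
proof (rule ccontr)
  let ?D = "reverse_arcs {e. flip e} (oriented_divisor_graph N)"
  interpret pair_fin_digraph ?D
    by (intro pair_fin_digraph_reverse_arcs pair_fin_digraph_oriented_divisor_graph)
  assume "\<not> ?thesis"
  then obtain d where d: "d \<in> mid_divisors n"
    and or: "(flip (n, 1) \<and> \<not> flip (n, d) \<and> \<not> flip (d, 1)) \<or>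
         (\<not> flip (n, 1) \<and> flip (n, d) \<and> flip (d, 1))"
    by blast
  have arcs: "{(n, 1), (n, d), (d, 1)} \<subseteq> parcs (oriented_divisor_graph N)"
    using d n by (auto simp: oriented_divisor_graph_def divisor_graph_def mid_divisors_def)
  from or have "1 \<rightarrow>\<^sup>*\<^bsub>?D\<^esub> n \<and> n \<rightarrow>\<^sup>*\<^bsub>?D\<^esub> 1"
  proof
    assume "flip (n, 1) \<and> \<not> flip (n, d) \<and> \<not> flip (d, 1)"
    then have "(1, n) \<in> parcs ?D" "(n, d) \<in> parcs ?D" "(d, 1) \<in> parcs ?D"
      using arcs by (auto simp: reverse_arcs_def)
    then show ?thesis by (meson reachable_adjI reachable_trans)
  next
    assume "\<not> flip (n, 1) \<and> flip (n, d) \<and> flip (d, 1)"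
    then have "(n, 1) \<in> parcs ?D" "(d, n) \<in> parcs ?D" "(1, d) \<in> parcs ?D"
      using arcs by (auto simp: reverse_arcs_def)
    then show ?thesis by (meson reachable_adjI reachable_trans)
  qed
  then show False using notin by (simp add: scc_of_def)
qed

lemma prob_in_scc_of_1:
  assumes n: "n \<in> {2..N}" and \<rho>: "\<rho> \<in> {0..1}"
  shows "measure_pmf.prob (random_divisor_graph \<rho> N) {D. n \<in> pre_digraph.scc_of (with_proj D) 1}
     \<ge> 1 - \<rho> * (2 * \<rho> - \<rho>\<^sup>2) ^ card (mid_divisors n) - (1 - \<rho>) * (1 - \<rho>\<^sup>2) ^ card (mid_divisors n)"
proof -
  let ?E = "parcs (oriented_divisor_graph N)"
  let ?P = "Pi_pmf ?E False (\<lambda>_. bernoulli_pmf \<rho>)"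
  let ?L = "mid_divisors n"
  let ?G = "{D. n \<in> pre_digraph.scc_of (with_proj D) 1}"
  let ?A = "{h. h (n, 1) \<and> (\<forall>d\<in>?L. h (n, d) \<or> h (d, 1))}"
  let ?B = "{h. \<not> h (n, 1) \<and> (\<forall>d\<in>?L. \<not> (h (n, d) \<and> h (d, 1)))}"
  let ?V = "(\<lambda>flip. reverse_arcs {e. flip e} (oriented_divisor_graph N)) -` ?G"
  have e: "(n, 1) \<in> ?E"
    using n by (auto simp: oriented_divisor_graph_def divisor_graph_def)
  \<comment> \<open>Every \<open>d\<close> lies strictly between 1 and \<open>n\<close>, so an arc
    out of \<open>n\<close> never equals an arc into 1 from another divisor.\<close>
  have disj: "disjoint_family_on (\<lambda>d. {(n, d), (d, 1)}) ?L"
    by (auto simp: disjoint_family_on_def mid_divisors_def)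
  have mem: "(n, d) \<in> ?E \<and> (d, 1) \<in> ?E \<and> (n, d) \<noteq> (d, 1) \<and> (n, d) \<noteq> (n, 1) \<and> (d, 1) \<noteq> (n, 1)"
    if "d \<in> ?L" for d
    using that n by (auto simp: oriented_divisor_graph_def divisor_graph_def mid_divisors_def)
  have "1 - measure_pmf.prob ?P ?V = measure_pmf.prob ?P (- ?V)"
    by (simp add: measure_pmf.prob_compl[of _ ?P, simplified] Compl_eq_Diff_UNIV)
  also have "\<dots> \<le> measure_pmf.prob ?P (?A \<union> ?B)"
    using not_in_scc_of_1[OF n] by (intro measure_pmf.finite_measure_mono) auto
  also have "\<dots> \<le> measure_pmf.prob ?P ?A + measure_pmf.prob ?P ?B"
    by (intro measure_Un_le) auto
  also have "\<dots> = \<rho> * (2 * \<rho> - \<rho>\<^sup>2) ^ card ?L + (1 - \<rho>) * (1 - \<rho>\<^sup>2) ^ card ?L"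
    using prob_coin_and_pairs[OF finite_parcs_oriented_divisor_graph \<rho> e finite_mid_divisors disj mem]
    by simp
  finally show ?thesis by (simp add: random_divisor_graph_def)
qed

text \<open>Powers of a base in (0, 1] decrease in the exponent. The base 0 must be excluded:
  \<open>0 ^ 0 = 1\<close>, but \<open>0 powr 0 = 0\<close>.\<close>

lemma power_le_powr:
  fixes a x :: real
  assumes "0 < a" "a \<le> 1" "x \<le> real k"
  shows "a ^ k \<le> a powr x"
  using assms powr_mono'[of x "real k" a] by (simp add: powr_realpow)

theorem theorem1:
  fixes N :: nat and \<rho> x y :: real
  assumes "N > 0"
    and "\<rho> \<in> {0..1}"
    and "x \<ge> 0"
    and "real (card {n \<in> {1..N}. real (tau n) - 2 \<ge> x}) \<ge> y"
  shows "measure_pmf.expectation (random_divisor_graph \<rho> N) (\<lambda>D. real (largest_scc_size D))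
           \<ge> y * (1 - \<rho> * (2 * \<rho> - \<rho>\<^sup>2) powr x - (1 - \<rho>) * (1 - \<rho>\<^sup>2) powr x)"
proof -
  define M where "M = random_divisor_graph \<rho> N"
  define S where "S = {n \<in> {1..N}. real (tau n) - 2 \<ge> x}"
  define a b where "a = 2 * \<rho> - \<rho>\<^sup>2" and "b = 1 - \<rho>\<^sup>2"
  define c where "c = 1 - \<rho> * a powr x - (1 - \<rho>) * b powr x"
  let ?G = "\<lambda>n. {D. n \<in> pre_digraph.scc_of (with_proj D) (1::nat)}"
  have \<rho>: "0 \<le> \<rho>" "\<rho> \<le> 1" using assms(2) by auto
  have ab: "0 \<le> a" "a \<le> 1" "0 \<le> b" "b \<le> 1"
  proof -
    show "0 \<le> a" using \<rho> mult_nonneg_nonneg[of \<rho> "2 - \<rho>"]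
      by (simp add: a_def power2_eq_square algebra_simps)
    show "a \<le> 1" using zero_le_power2[of "1 - \<rho>"]
      by (simp add: a_def power2_eq_square algebra_simps)
    show "0 \<le> b" "b \<le> 1" using \<rho> by (auto simp: b_def power_le_one)
  qed
  \<comment> \<open>Nonnegativity is what later allows \<open>y \<le> card S\<close> to be
    multiplied by \<open>c\<close>; it holds because a weighted mean of two numbers at most 1 is at
    most 1.\<close>
  have "c \<ge> 0"
  proof -
    have "\<rho> * a powr x \<le> \<rho> * 1" "(1 - \<rho>) * b powr x \<le> (1 - \<rho>) * 1"
      using \<rho> ab assms(3) by (intro mult_left_mono powr_le1; simp)+
    then show ?thesis by (simp add: c_def)
  qed
  have finS: "finite S" by (simp add: S_def)
  \<comment> \<open>The vertex 1 drops out of \<open>S\<close>, since \<open>tau 1 - 2\<close> is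
    negative while \<open>x \<ge> 0\<close>.\<close>
  have S: "n \<in> {2..N}" "x \<le> real (card (mid_divisors n))" if "n \<in> S" for n
  proof -
    have "{d. d > 0 \<and> d dvd 1} = {1::nat}" by auto
    then have "tau 1 = 1" by (simp add: tau_def)
    then have "n \<noteq> 1" using that assms(3) by (auto simp: S_def)
    then show "n \<in> {2..N}" using that by (auto simp: S_def)
    then show "x \<le> real (card (mid_divisors n))"
      using that card_mid_divisors[of n] by (simp add: S_def)
  qed
  have prob: "c \<le> measure_pmf.prob M (?G n)" if "n \<in> S" for n
  proof -
    let ?k = "card (mid_divisors n)"
    have "\<rho> * a ^ ?k \<le> \<rho> * a powr x"
    \<comment> \<open>The base \<open>a = \<rho> * (2 - \<rho>)\<close> vanishes only for
      \<open>\<rho> = 0\<close>, where the prefactor makes both sides 0.\<close>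
    proof (cases "\<rho> = 0")
      case False
      then have "a > 0" using \<rho> mult_pos_pos[of \<rho> "2 - \<rho>"]
        by (simp add: a_def power2_eq_square algebra_simps)
      then show ?thesis using power_le_powr[of a x ?k] ab S(2)[OF that] \<rho> by (intro mult_left_mono) auto
    qed simp
    moreover have "(1 - \<rho>) * b ^ ?k \<le> (1 - \<rho>) * b powr x"
    \<comment> \<open>Likewise \<open>b\<close> vanishes only for \<open>\<rho> = 1\<close>,
      together with its prefactor \<open>1 - \<rho>\<close>.\<close>
    proof (cases "\<rho> = 1")
      case False
      then have "b > 0" using \<rho> mult_pos_pos[of "1 - \<rho>" "1 + \<rho>"]
        by (simp add: b_def power2_eq_square algebra_simps)
      then show ?thesis using power_le_powr[of b x ?k] ab S(2)[OF that] \<rho> by (intro mult_left_mono) auto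
    qed simp
    ultimately show ?thesis
      using prob_in_scc_of_1[OF S(1)[OF that] assms(2)] by (simp add: M_def c_def a_def b_def)
  qed
  \<comment> \<open>Finite support makes every real function integrable under
    \<open>M\<close>.\<close>
  have "finite (set_pmf (Pi_pmf (parcs (oriented_divisor_graph N)) False (\<lambda>_. bernoulli_pmf \<rho>)))"
    by (rule finite_subset[OF set_Pi_pmf_subset'])
      (auto intro!: finite_PiE_dflt finite_parcs_oriented_divisor_graph)
  then have finM: "finite (set_pmf M)" by (simp add: M_def random_divisor_graph_def)
  \<comment> \<open>For a fixed digraph the sum counts the members of \<open>S\<close> in the
    component of 1.\<close>
  have size: "(\<Sum>n\<in>S. indicator (?G n) D) \<le> real (largest_scc_size D)" if "D \<in> set_pmf M" for D
  proof -
    obtain R where D: "D = reverse_arcs R (oriented_divisor_graph N)"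
      using \<open>D \<in> set_pmf M\<close> by (auto simp: M_def random_divisor_graph_def)
    interpret pair_fin_digraph D
      unfolding D by (intro pair_fin_digraph_reverse_arcs pair_fin_digraph_oriented_divisor_graph)
    have one: "1 \<in> pverts D" using assms(1)
      by (simp add: D reverse_arcs_def oriented_divisor_graph_def divisor_graph_def)
    have "finite (scc_of 1)"
      by (rule finite_subset[of _ "pverts D"]) (auto simp: scc_of_def dest: reachable_in_verts)
    have "(\<Sum>n\<in>S. indicator (?G n) D :: real) = (\<Sum>n\<in>S. indicator (scc_of 1) n)"
      by (intro sum.cong) (auto simp: indicator_def)
    also have "\<dots> = real (card (S \<inter> scc_of 1))"
      using finS by (simp add: indicator_def Collect_conj_eq flip: sum.inter_filter)
    also have "\<dots> \<le> real (card (scc_of 1))"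
      using \<open>finite (scc_of 1)\<close> by (intro of_nat_mono card_mono) auto
    also have "\<dots> \<le> real (largest_scc_size D)"
      using card_scc_of_le_largest_scc_size[OF one] by simp
    finally show ?thesis .
  qed
  have "y * c \<le> real (card S) * c"
    using assms(4) \<open>c \<ge> 0\<close> by (intro mult_right_mono) (auto simp: S_def)
  also have "\<dots> = (\<Sum>n\<in>S. c)" by simp
  also have "\<dots> \<le> (\<Sum>n\<in>S. measure_pmf.prob M (?G n))"
    by (intro sum_mono prob)
  also have "\<dots> = measure_pmf.expectation M (\<lambda>D. \<Sum>n\<in>S. indicator (?G n) D)"
    by (subst Bochner_Integration.integral_sum)
      (auto intro!: integrable_measure_pmf_finite finM)
  also have "\<dots> \<le> measure_pmf.expectation M (\<lambda>D. real (largest_scc_size D))"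
    by (intro integral_mono_AE integrable_measure_pmf_finite finM)
      (use size in \<open>simp add: AE_measure_pmf_iff\<close>)
  finally show ?thesis by (simp add: M_def c_def a_def b_def)
qed

end
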